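(* Consider an integer linear program $\min\{c(x) : x\in\mathcal{X}\}$, where $\mathcal{X}$ is a set of $m\times n$ binary matrices, whose symmetry group is the group of all column permutations. Let $\tau$ be a branch-and-bound (B\&B) tree of this program in which dynamic orbitopal fixing is performed and in which the branching disjunction at each branched node $a$ has the form $x_{i_a,j_a}=0\ \vee\ x_{i_a,j_a}=1$. Then for each solution orbit $\mathcal{O}$ of the program, there is exactly one solution of $\mathcal{O}$ enumerated in the B\&B tree $\tau$.
   Context: Symmetry: the symmetry group is the symmetric group $\mathfrak{S}_n$ acting on columns: for every $x\in\mathcal{X}$ and every column permutation $\pi$, $\pi(x)\in\mathcal{X}$ and $c(\pi(x))=c(x)$. Solution orbits are the orbits of $\mathcal{X}$ under this action. Lexicographic order and full orbitope: for $y,z\in\{0,1\}^k$, $y\succeq z$ if $y=z$ or, at the first row where they differ, $y$ has a $1$ and $z$ a $0$. The full orbitope $\mathcal{P}_0(k,n)$ is the convex hull of all $k\times n$ binary matrices $X$ whose columns satisfy $X(j)\succeq X(j+1)$ for all $j<n$. For disjoint index sets $(I_0,I_1)$ the corresponding face of $[0,1]^{(k,n)}$ is $F=\{x : x_{i,j}=0\ \forall(i,j)\in I_0,\ x_{i,j}=1\ \forall (i,j)\in I_1\}$; $\mathrm{Fix}_F(P)$ is the smallest face of $[0,1]^{(k,n)}$ (possibly empty) containing $P\cap F\cap\{0,1\}^{(k,n)}$, and $(I_0^{\star},I_1^{\star})$ are the index sets giving it when non-empty. B\&B tree: each node $a$ corresponds to a subproblem in which some variables have been fixed by previous branching decisions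 and by previous orbitopal fixings. Branching at $a$ with the disjunction $x_{i_a,j_a}=0\vee x_{i_a,j_a}=1$ creates two children in which $x_{i_a,j_a}$ is fixed to $0$, respectively $1$ (a child contradicting an earlier fixing is infeasible). Apart from orbitopal fixing, nodes are discarded only when their subproblem is infeasible (pruning by cost bounds is disregarded), and branching proceeds until leaves, where all variables are fixed. A solution $x\in\mathcal{X}$ is enumerated in $\tau$ if it is the solution of some non-pruned leaf. Row orderings: for each branched node $a$, a row set $I_a\subset\{1,\dots,m\}$ and a bijection $\phi_a:\{1,\dots,|I_a|\}\to I_a$ are defined recursively. If $a$ is the root, $I_a=\{i_a\}$ and $\phi_a(1)=i_a$. Otherwise, with $b$ the father of $a$, $I_a=I_b\cup\{i_a\}$, $\phi_a(i)=\phi_b(i)$ for $i\in\{1,\dots,|I_b|\}$, and $\phi_a(|I_b|+1)=i_a$ if $i_a\notin I_b$. At a leaf (no branching), $I_a=I_b$ and $\phi_a=\phi_b$ for its father $b$. Dynamic orbitopal fixing: at each node $a$, orbitopal fixing is performed on the rows $\phi_a(1),\dots,\phi_a(|I_a|)$ in this order. That is, with $k=|I_a|$, let $Y(r,j)=x_{\phi_a(r),j}$ for $r\in\{1,\dots,k\}$, $j\in\{1,\dots,n\}$, and let $F$ be the face of $[0,1]^{(k,n)}$ given by the entries of $Y$ previously fixed to $0$ and to $1$; compute $\mathrm{Fix}_F(\mathcal{P}_0(k,n))$; if it is empty, prune $a$; otherwise fix to $0$ every variable $Y(r,j)$ with $(r,j)\in I_0^{\star}$ and to $1$ every variable $Y(r,j)$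 with $(r,j)\in I_1^{\star}$. *)

theory Defs
  imports "HOL-Analysis.Analysis" "HOL-Analysis.Finite_Function_Topology"
    "HOL-Combinatorics.Permutations"
begin

section \<open>Matrices and the unit cube\<close>

text \<open>
  The number of rows of the matrices below varies within one statement (it grows along a
  branch-and-bound tree), so real matrices of all sizes live in one real vector space, that of
  finitely supported functions on pairs (row, column). A matrix of size \<open>k \<times> n\<close> vanishes outside
  \<open>{..<k} \<times> {..<n}\<close>; rows and columns are numbered from 0.
\<close>

type_synonym rmat = "(nat \<times> nat) \<Rightarrow>\<^sub>0 real"

abbreviation entry :: "rmat \<Rightarrow> nat \<Rightarrow> nat \<Rightarrow> real" where
  "entry x i j \<equiv> Poly_Mapping.lookup x (i, j)"

definition unit_cube :: "nat \<Rightarrow> nat \<Rightarrow> rmat set" where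
  "unit_cube k n = {x. Poly_Mapping.keys x \<subseteq> {..<k} \<times> {..<n} \<and>
                       (\<forall>i<k. \<forall>j<n. 0 \<le> entry x i j \<and> entry x i j \<le> 1)}"

definition binary_mats :: "nat \<Rightarrow> nat \<Rightarrow> rmat set" where
  "binary_mats k n = {x. Poly_Mapping.keys x \<subseteq> {..<k} \<times> {..<n} \<and>
                         (\<forall>i<k. \<forall>j<n. entry x i j \<in> {0, 1})}"

text \<open>A pair \<open>(I\<^sub>0, I\<^sub>1)\<close>: the positions fixed to 0 and the positions fixed to 1.\<close>

type_synonym fixing = "(nat \<times> nat) set \<times> (nat \<times> nat) set"

definition satisfies :: "rmat \<Rightarrow> fixing \<Rightarrow> bool" where
  "satisfies x S \<longleftrightarrow> (\<forall>(i, j) \<in> fst S. entry x i j = 0) \<and> (\<forall>(i, j) \<in> snd S. entry x i j = 1)"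

text \<open>If the two components are not disjoint (contradictory fixings), this is the empty face.\<close>

definition cube_face :: "nat \<Rightarrow> nat \<Rightarrow> fixing \<Rightarrow> rmat set" where
  "cube_face k n S = {x \<in> unit_cube k n. satisfies x S}"


section \<open>Column symmetry\<close>

text \<open>
  The value of \<open>map_key f\<close> is only meaningful for injective \<open>f\<close>; this is the case when \<open>\<pi>\<close> is a
  permutation, see the lemma below.
\<close>

definition permute_columns :: "(nat \<Rightarrow> nat) \<Rightarrow> rmat \<Rightarrow> rmat" where
  "permute_columns \<pi> x = Poly_Mapping.map_key (\<lambda>(i, j). (i, \<pi> j)) x"

lemma entry_permute_columns:
  assumes "\<pi> permutes A"
  shows "entry (permute_columns \<pi> x) i j = entry x i (\<pi> j)"
proof -
  have "inj (\<lambda>(i::nat, j). (i, \<pi> j))"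
    using permutes_inj[OF assms] by (auto simp: inj_on_def)
  then show ?thesis
    by (simp add: permute_columns_def map_key.rep_eq)
qed

definition column_symmetric_ilp :: "nat \<Rightarrow> nat \<Rightarrow> rmat set \<Rightarrow> (rmat \<Rightarrow> real) \<Rightarrow> bool" where
  "column_symmetric_ilp m n X c \<longleftrightarrow>
     X \<subseteq> binary_mats m n \<and> linear c \<and>
     (\<forall>x\<in>X. \<forall>\<pi>. \<pi> permutes {..<n} \<longrightarrow>
        permute_columns \<pi> x \<in> X \<and> c (permute_columns \<pi> x) = c x)"

definition solution_orbits :: "nat \<Rightarrow> rmat set \<Rightarrow> rmat set set" where
  "solution_orbits n X = {{permute_columns \<pi> x |\<pi>. \<pi> permutes {..<n}} |x. x \<in> X}"


section \<open>Full orbitope and orbitopal fixing\<close>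

definition lex_geq :: "nat \<Rightarrow> (nat \<Rightarrow> real) \<Rightarrow> (nat \<Rightarrow> real) \<Rightarrow> bool" where
  "lex_geq k y z \<longleftrightarrow>
     (\<forall>i<k. y i = z i) \<or> (\<exists>i<k. (\<forall>i'<i. y i' = z i') \<and> y i = 1 \<and> z i = 0)"

definition full_orbitope :: "nat \<Rightarrow> nat \<Rightarrow> rmat set" where
  "full_orbitope k n =
     convex hull {x \<in> binary_mats k n.
       \<forall>j. Suc j < n \<longrightarrow> lex_geq k (\<lambda>i. entry x i j) (\<lambda>i. entry x i (Suc j))}"

definition Fix_face :: "nat \<Rightarrow> nat \<Rightarrow> rmat set \<Rightarrow> rmat set \<Rightarrow> rmat set" where
  "Fix_face k n F P = (\<lambda>G. G face_of unit_cube k n) hull (P \<inter> F \<inter> binary_mats k n)"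

text \<open>The index sets describing \<open>Fix_face k n F P\<close>; only used when this face is nonempty.\<close>

definition fix_indices :: "nat \<Rightarrow> nat \<Rightarrow> rmat set \<Rightarrow> rmat set \<Rightarrow> fixing" where
  "fix_indices k n F P =
     (THE J. fst J \<subseteq> {..<k} \<times> {..<n} \<and> snd J \<subseteq> {..<k} \<times> {..<n} \<and> fst J \<inter> snd J = {} \<and>
             cube_face k n J = Fix_face k n F P)"


section \<open>Branch-and-bound with dynamic orbitopal fixing\<close>

text \<open>
  A set of rows together with its ordering is the duplicate-free list \<open>\<phi>\<close> of these rows.
  The matrix \<open>Y\<close> of the selected rows, \<open>Y r j = x (\<phi> ! r) j\<close>, enters only through the positions
  of \<open>Y\<close> that are fixed.
\<close>

definition add_row :: "nat list \<Rightarrow> nat \<Rightarrow> nat list" where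
  "add_row \<phi> i = (if i \<in> set \<phi> then \<phi> else \<phi> @ [i])"

definition restrict_fixing :: "nat \<Rightarrow> nat list \<Rightarrow> fixing \<Rightarrow> fixing" where
  "restrict_fixing n \<phi> S =
     ({(r, j). r < length \<phi> \<and> j < n \<and> (\<phi> ! r, j) \<in> fst S},
      {(r, j). r < length \<phi> \<and> j < n \<and> (\<phi> ! r, j) \<in> snd S})"

text \<open>
  The fixings after orbitopal fixing on the rows \<open>\<phi>\<close>, starting from the fixings \<open>S\<close>;
  \<open>None\<close> if the node has to be pruned.
\<close>

definition orbitopal_fixing :: "nat \<Rightarrow> nat list \<Rightarrow> fixing \<Rightarrow> fixing option" where
  "orbitopal_fixing n \<phi> S =
     (let k = length \<phi>;
          F = cube_face k n (restrict_fixing n \<phi> S);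
          P = full_orbitope k n;
          J = fix_indices k n F P
      in if Fix_face k n F P = {} then None
         else Some (fst S \<union> {(\<phi> ! r, j) |r j. (r, j) \<in> fst J},
                    snd S \<union> {(\<phi> ! r, j) |r j. (r, j) \<in> snd J}))"

text \<open>
  A leaf carries its final fixings; a branched node carries the branching variable \<open>(i, j)\<close>, the
  child with entry \<open>(i, j)\<close> fixed to 0 and the child with that entry fixed to 1.
\<close>

datatype bb_tree =
    Pruned
  | Leaf fixing
  | Branch "nat \<times> nat" bb_tree bb_tree

text \<open>
  In \<open>dof_tree m n X \<phi> S t\<close>, \<open>\<phi>\<close> is the row ordering of the father of the root of \<open>t\<close> and \<open>S\<close>
  contains the fixings with which this root was created.
  A branched node first extends the row ordering by its own branching row and only then performs
  orbitopal fixing. A branching variable may be already fixed; one of the children then carries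
  contradictory fixings, and orbitopal fixing prunes it.
\<close>

inductive dof_tree :: "nat \<Rightarrow> nat \<Rightarrow> rmat set \<Rightarrow> nat list \<Rightarrow> fixing \<Rightarrow> bb_tree \<Rightarrow> bool"
  for m n :: nat and X :: "rmat set" where
  pruned_by_fixing:
    "orbitopal_fixing n \<phi> S = None \<Longrightarrow> dof_tree m n X \<phi> S Pruned"
| infeasible:
    "\<lbrakk>orbitopal_fixing n \<phi> S = Some T; \<not> (\<exists>x\<in>X. satisfies x T)\<rbrakk>
     \<Longrightarrow> dof_tree m n X \<phi> S Pruned"
| leaf:
    "\<lbrakk>orbitopal_fixing n \<phi> S = Some T; fst T \<union> snd T = {..<m} \<times> {..<n}\<rbrakk>
     \<Longrightarrow> dof_tree m n X \<phi> S (Leaf T)"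
| branch:
    "\<lbrakk>i < m; j < n; orbitopal_fixing n (add_row \<phi> i) S = Some (T0, T1);
      dof_tree m n X (add_row \<phi> i) (insert (i, j) T0, T1) t0;
      dof_tree m n X (add_row \<phi> i) (T0, insert (i, j) T1) t1\<rbrakk>
     \<Longrightarrow> dof_tree m n X \<phi> S (Branch (i, j) t0 t1)"

definition dynamic_orbitopal_bb_tree :: "nat \<Rightarrow> nat \<Rightarrow> rmat set \<Rightarrow> bb_tree \<Rightarrow> bool" where
  "dynamic_orbitopal_bb_tree m n X \<tau> \<longleftrightarrow> dof_tree m n X [] ({}, {}) \<tau>"

primrec leaves :: "bb_tree \<Rightarrow> fixing set" where
  "leaves Pruned = {}"
| "leaves (Leaf T) = {T}"
| "leaves (Branch v t0 t1) = leaves t0 \<union> leaves t1"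

definition enumerated :: "rmat set \<Rightarrow> bb_tree \<Rightarrow> rmat set" where
  "enumerated X \<tau> = {x \<in> X. \<exists>T \<in> leaves \<tau>. satisfies x T}"

end

theory Submission
  imports Defs "HOL-Library.List_Lexorder"
begin

text \<open>
  Call a matrix sorted on a row ordering \<open>\<phi>\<close> if its columns, read along \<open>\<phi>\<close> only, are
  lexicographically nonincreasing. Orbitopal fixing on \<open>\<phi>\<close> is exact for the sorted matrices: it
  prunes a node iff no binary choice of the rows \<open>\<phi>\<close> is sorted and respects the current fixings,
  and otherwise it fixes exactly the entries on which all such choices agree
  (\<open>orbitopal_fixing_eq_None_iff\<close>, \<open>orbitopal_fixing_eq_SomeD\<close>). This is because the smallest face of
  the cube containing a nonempty set of vertices is cut out by their common entries
  (\<open>face_hull_binary_eq\<close>), and the binary points of the full orbitope are exactly the sorted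
  matrices (\<open>binary_in_convex_hull\<close>). Two facts about sorting turn this local statement into the
  theorem.

  First, every orbit contains a matrix that is sorted on \<open>\<phi>\<close> (\<open>ex_columns_sorted_in_orbit\<close>), and any
  two matrices of one orbit that are sorted on \<open>\<phi>\<close> coincide on the rows \<open>\<phi>\<close>, because both
  list the same multiset of partial columns in the same order (\<open>columns_sorted_agree\<close>). Second,
  all fixings at a node concern rows of its ordering, and orderings only grow at their end along the
  tree, so that being sorted on the ordering of a node implies the same for its ancestors.

  Existence follows by walking down the tree while carrying an element of the orbit that is
  sorted on the current ordering and respects the current fixings. When the ordering gains a row, the
  carried element is replaced by one that is sorted on the longer ordering; the two agree on the old
  rows, hence the fixings stay respected, orbitopal fixing neither prunes nor excludes the
  new element, and its entry at the branching position selects the child (\<open>enumerated_exists\<close>).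

  Uniqueness follows because a solution of a leaf is sorted on the orderings of all nodes above it
  (\<open>leaf_solution_sorted\<close>). Two enumerated elements of one orbit therefore agree on the
  branching row of every node that they share, so they never separate, and a leaf
  has at most one solution (\<open>enumerated_unique\<close>).
\<close>

section \<open>Faces of the unit cube\<close>

lemma lookup_scaleR: "Poly_Mapping.lookup (r *\<^sub>R x) p = r * (Poly_Mapping.lookup x p :: real)"
proof -
  have "{p. r *\<^sub>R Poly_Mapping.lookup x p \<noteq> 0} \<subseteq> Poly_Mapping.keys x"
    unfolding real_scaleR_def by (rule subsetI) (simp add: in_keys_iff)
  then have "finite {p. r *\<^sub>R Poly_Mapping.lookup x p \<noteq> 0}"
    using finite_keys by (rule finite_subset)
  then have "Poly_Mapping.lookup (r *\<^sub>R x) = (\<lambda>p. r *\<^sub>R Poly_Mapping.lookup x p)"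
    unfolding scaleR_poly_mapping_def by (rule lookup_Abs_poly_mapping)
  then show ?thesis
    by (simp only: real_scaleR_def)
qed

lemma rmat_eqI: "x = y" if "\<And>i j. entry x i j = entry y i j"
proof (rule poly_mapping_eqI)
  fix p :: "nat \<times> nat"
  show "Poly_Mapping.lookup x p = Poly_Mapping.lookup y p"
    by (cases p) (simp add: that)
qed

definition matrix :: "nat \<Rightarrow> nat \<Rightarrow> (nat \<Rightarrow> nat \<Rightarrow> real) \<Rightarrow> rmat" where
  "matrix k n f = Abs_poly_mapping (\<lambda>(i, j). if i < k \<and> j < n then f i j else 0)"

lemma entry_matrix: "entry (matrix k n f) i j = (if i < k \<and> j < n then f i j else 0)"
proof -
  have "{p. (case p of (i, j) \<Rightarrow> if i < k \<and> j < n then f i j else 0) \<noteq> 0} \<subseteq> {..<k} \<times> {..<n}"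
    by (auto split: if_splits)
  then have "finite {p. (case p of (i, j) \<Rightarrow> if i < k \<and> j < n then f i j else 0) \<noteq> 0}"
    by (rule finite_subset) simp
  then show ?thesis
    by (simp add: matrix_def)
qed

lemma keys_subset_grid_iff:
  fixes x :: rmat
  shows "Poly_Mapping.keys x \<subseteq> {..<k} \<times> {..<n} \<longleftrightarrow>
     (\<forall>i j. \<not> (i < k \<and> j < n) \<longrightarrow> entry x i j = 0)"
proof -
  have "Poly_Mapping.keys x \<subseteq> {..<k} \<times> {..<n} \<longleftrightarrow>
      (\<forall>i j. (i, j) \<in> Poly_Mapping.keys x \<longrightarrow> (i, j) \<in> {..<k} \<times> {..<n})"
    by (rule subset_iff[THEN trans]) (rule split_paired_All)
  then show ?thesis
    unfolding in_keys_iff mem_Sigma_iff lessThan_iff by blast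
qed

lemma unit_cube_iff:
  "x \<in> unit_cube k n \<longleftrightarrow>
     (\<forall>i j. (i < k \<and> j < n \<longrightarrow> 0 \<le> entry x i j \<and> entry x i j \<le> 1) \<and>
            (\<not> (i < k \<and> j < n) \<longrightarrow> entry x i j = 0))"
  unfolding unit_cube_def keys_subset_grid_iff by blast

lemma binary_mats_iff:
  "x \<in> binary_mats k n \<longleftrightarrow>
     (\<forall>i j. (i < k \<and> j < n \<longrightarrow> entry x i j = 0 \<or> entry x i j = 1) \<and>
            (\<not> (i < k \<and> j < n) \<longrightarrow> entry x i j = 0))"
  unfolding binary_mats_def keys_subset_grid_iff by blast

lemma binary_mats_subset_unit_cube: "binary_mats k n \<subseteq> unit_cube k n"
proof
  fix x assume "x \<in> binary_mats k n"
  then have x: "Poly_Mapping.keys x \<subseteq> {..<k} \<times> {..<n}" "\<And>i j. i < k \<Longrightarrow> j < n \<Longrightarrow> entry x i j \<in> {0, 1}"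
    by (simp_all add: binary_mats_def)
  have "0 \<le> entry x i j \<and> entry x i j \<le> 1" if "i < k" "j < n" for i j
    using x(2)[OF that] by auto
  then show "x \<in> unit_cube k n"
    unfolding unit_cube_def using x(1) by simp
qed

lemma binary_mats_entry: "x \<in> binary_mats k n \<Longrightarrow> entry x i j = 0 \<or> entry x i j = 1"
  unfolding binary_mats_iff by blast

lemma unit_cube_entry: "x \<in> unit_cube k n \<Longrightarrow> 0 \<le> entry x i j \<and> entry x i j \<le> 1"
  unfolding unit_cube_iff by (cases "i < k \<and> j < n") auto

lemma finite_binary_mats: "finite (binary_mats k n)"
proof (rule inj_on_finite)
  show "inj_on Poly_Mapping.keys (binary_mats k n)"
  proof (rule inj_onI, rule rmat_eqI)
    fix x y :: rmat and i j
    assume "x \<in> binary_mats k n" "y \<in> binary_mats k n"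
      and "Poly_Mapping.keys x = Poly_Mapping.keys y"
    then show "entry x i j = entry y i j"
      using binary_mats_entry by (metis in_keys_iff)
  qed
  show "Poly_Mapping.keys ` binary_mats k n \<subseteq> Pow ({..<k} \<times> {..<n})"
    by (auto simp: binary_mats_def)
qed simp

lemma convex_unit_cube: "convex (unit_cube k n)"
proof (rule convexI)
  fix x y :: rmat and u v :: real
  assume x: "x \<in> unit_cube k n" and y: "y \<in> unit_cube k n" and uv: "0 \<le> u" "0 \<le> v" "u + v = 1"
  have "0 \<le> u * entry x i j + v * entry y i j" "u * entry x i j + v * entry y i j \<le> 1" for i j
    using unit_cube_entry[OF x, of i j] unit_cube_entry[OF y, of i j] uv
    by (auto intro: convex_bound_le)
  moreover have "u * entry x i j + v * entry y i j = 0" if "\<not> (i < k \<and> j < n)" for i j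
    using x y that unfolding unit_cube_iff by simp
  ultimately show "u *\<^sub>R x + v *\<^sub>R y \<in> unit_cube k n"
    unfolding unit_cube_iff by (simp add: lookup_add lookup_scaleR)
qed

lemma entry_open_segment:
  assumes "x \<in> open_segment a b"
  obtains u where "0 < u" "u < 1" "\<And>i j. entry x i j = (1 - u) * entry a i j + u * entry b i j"
proof -
  obtain u where u: "0 < u" "u < 1" "x = (1 - u) *\<^sub>R a + u *\<^sub>R b"
    using assms unfolding in_segment by blast
  have "entry x i j = (1 - u) * entry a i j + u * entry b i j" for i j
    unfolding u(3) by (simp add: lookup_add lookup_scaleR)
  then show ?thesis
    using that u(1,2) by blast
qed

text \<open>Algebraically, these two facts say that 0 and 1 are extreme points of the unit interval.\<close>

lemma convex_combination_eq_0:
  fixes u a b :: real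
  assumes "0 < u" "u < 1" "0 \<le> a" "0 \<le> b" "(1 - u) * a + u * b = 0"
  shows "a = 0 \<and> b = 0"
  using assms by (smt (verit) mult_nonneg_nonneg mult_pos_pos)

lemma convex_combination_eq_1:
  fixes u a b :: real
  assumes "0 < u" "u < 1" "a \<le> 1" "b \<le> 1" "(1 - u) * a + u * b = 1"
  shows "a = 1 \<and> b = 1"
  using convex_combination_eq_0[of u "1 - a" "1 - b"] assms by (simp add: algebra_simps)

lemma cube_face_face_of: "cube_face k n S face_of unit_cube k n"
  unfolding face_of_def
proof (intro conjI ballI impI)
  show "cube_face k n S \<subseteq> unit_cube k n"
    by (auto simp: cube_face_def)
  show "convex (cube_face k n S)"
  proof (rule convexI)
    fix x y :: rmat and u v :: real
    assume "x \<in> cube_face k n S" "y \<in> cube_face k n S" "0 \<le> u" "0 \<le> v" "u + v = 1"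
    then show "u *\<^sub>R x + v *\<^sub>R y \<in> cube_face k n S"
      using convexD[OF convex_unit_cube]
      by (fastforce simp: cube_face_def satisfies_def lookup_add lookup_scaleR)
  qed
next
  fix a b x
  assume a: "a \<in> unit_cube k n" and b: "b \<in> unit_cube k n"
    and x: "x \<in> cube_face k n S" and "x \<in> open_segment a b"
  then obtain u where u: "0 < u" "u < 1"
    "\<And>i j. entry x i j = (1 - u) * entry a i j + u * entry b i j"
    by (elim entry_open_segment) blast
  have "entry a i j = 0 \<and> entry b i j = 0" if "(i, j) \<in> fst S" for i j
    using convex_combination_eq_0[OF u(1,2), of "entry a i j" "entry b i j"] x that u(3)[of i j]
      unit_cube_entry[OF a] unit_cube_entry[OF b]
    by (auto simp: cube_face_def satisfies_def)
  moreover have "entry a i j = 1 \<and> entry b i j = 1" if "(i, j) \<in> snd S" for i j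
    using convex_combination_eq_1[OF u(1,2), of "entry a i j" "entry b i j"] x that u(3)[of i j]
      unit_cube_entry[OF a] unit_cube_entry[OF b]
    by (auto simp: cube_face_def satisfies_def)
  ultimately show "a \<in> cube_face k n S" "b \<in> cube_face k n S"
    using a b by (auto simp: cube_face_def satisfies_def)
qed

definition constant_positions :: "nat \<Rightarrow> nat \<Rightarrow> rmat set \<Rightarrow> fixing" where
  "constant_positions k n V =
     ({(i, j). i < k \<and> j < n \<and> (\<forall>v\<in>V. entry v i j = 0)},
      {(i, j). i < k \<and> j < n \<and> (\<forall>v\<in>V. entry v i j = 1)})"

text \<open>
  The barycentre \<open>b\<close> of \<open>V\<close> lies in every face containing \<open>V\<close>, and off the constant positions its
  entries are at distance at least \<open>1 / card V\<close> from 0 and 1. So every segment from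
  a point of the candidate face to \<open>b\<close> can be prolonged a little beyond \<open>b\<close> within the cube, and a
  face that contains \<open>b\<close> contains such a segment.
\<close>

lemma face_hull_binary_eq:
  assumes V: "V \<subseteq> binary_mats k n" "V \<noteq> {}"
  shows "(\<lambda>G. G face_of unit_cube k n) hull V = cube_face k n (constant_positions k n V)"
proof (rule hull_unique)
  let ?J = "constant_positions k n V"
  show "V \<subseteq> cube_face k n ?J"
    using V binary_mats_subset_unit_cube
    by (auto simp: cube_face_def satisfies_def constant_positions_def)
  show "cube_face k n ?J face_of unit_cube k n"
    by (rule cube_face_face_of)
  fix G
  assume VG: "V \<subseteq> G" and G: "G face_of unit_cube k n"
  have fin: "finite V"
    using V(1) finite_binary_mats finite_subset by blast
  define e :: real where "e = 1 / card V"
  have card: "card V > 0"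
    using fin V(2) by (simp add: card_gt_0_iff)
  have e: "0 < e" "e \<le> 1" "card V * e = 1"
    using card by (auto simp: e_def)
  define b where "b = (\<Sum>v\<in>V. e *\<^sub>R v)"
  have "convex G"
    using G by (simp add: face_of_def)
  then have "b \<in> G"
    unfolding b_def using fin e VG by (intro convex_sum) auto
  have entry_b: "entry b i j = (\<Sum>v\<in>V. e * entry v i j)" for i j
    by (simp add: b_def lookup_sum lookup_scaleR)
  have V_bounds: "0 \<le> entry v i j" "entry v i j \<le> 1" if "v \<in> V" for v i j
    using unit_cube_entry[of v k n i j] that V(1) binary_mats_subset_unit_cube by blast+
  have b_low: "e \<le> entry b i j" if "v \<in> V" "entry v i j = 1" for v i j
  proof -
    have "e * entry v i j \<le> entry b i j"
      unfolding entry_b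
      by (rule member_le_sum) (simp_all add: that fin e(1) less_imp_le V_bounds)
    then show ?thesis using that by simp
  qed
  have b_high: "entry b i j \<le> 1 - e" if "v \<in> V" "entry v i j = 0" for v i j
  proof -
    have "e * (1 - entry v i j) \<le> (\<Sum>v\<in>V. e * (1 - entry v i j))"
      by (rule member_le_sum[where f = "\<lambda>v. e * (1 - entry v i j)"])
        (simp_all add: that fin e(1) less_imp_le V_bounds)
    also have "\<dots> = 1 - entry b i j"
      unfolding entry_b using e by (simp add: right_diff_distrib sum_subtractf)
    finally show ?thesis using that by simp
  qed
  show "cube_face k n ?J \<subseteq> G"
  proof
    fix y assume y: "y \<in> cube_face k n ?J"
    then have y_cube: "y \<in> unit_cube k n"
      by (simp add: cube_face_def)
    (* The prolongation of the segment from y to b by the factor e: since the entries of b keep the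
       distance e from 0 and 1 off the constant positions, z does not leave the cube. *)
    define z where "z = b + e *\<^sub>R (b - y)"
    have entry_z: "entry z i j = entry b i j + e * (entry b i j - entry y i j)" for i j
      by (simp add: z_def lookup_add lookup_scaleR lookup_minus)
    have z_bounds: "0 \<le> entry z i j \<and> entry z i j \<le> 1" if ij: "i < k" "j < n" for i j
    proof -
      consider "\<forall>v\<in>V. entry v i j = 0" | "\<forall>v\<in>V. entry v i j = 1"
        | v w where "v \<in> V" "entry v i j = 1" "w \<in> V" "entry w i j = 0"
        using V(1) binary_mats_entry by blast
      then show ?thesis
      proof cases
        case 1
        then have "entry y i j = 0" "entry b i j = 0"
          using y ij by (auto simp: cube_face_def satisfies_def constant_positions_def entry_b)
        then show ?thesis by (simp add: entry_z)
      next
        case 2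
        then have "entry y i j = 1" "entry b i j = 1"
          using y ij e(3) by (auto simp: cube_face_def satisfies_def constant_positions_def entry_b)
        then show ?thesis by (simp add: entry_z)
      next
        case 3
        then have bb: "e \<le> entry b i j" "entry b i j \<le> 1 - e"
          using b_low b_high by blast+
        have yy: "0 \<le> entry y i j" "entry y i j \<le> 1"
          using unit_cube_entry[OF y_cube] by auto
        have "e * (-1) \<le> e * (entry b i j - entry y i j)"
          using bb yy e by (intro mult_left_mono) auto
        moreover have "e * (entry b i j - entry y i j) \<le> e * 1"
          using bb yy e by (intro mult_left_mono) auto
        ultimately show ?thesis
          using bb unfolding entry_z by linarith
      qed
    qed
    have "b \<in> unit_cube k n"
      using \<open>b \<in> G\<close> G face_of_imp_subset by blast
    then have z_cube: "z \<in> unit_cube k n"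
      using z_bounds y_cube unfolding unit_cube_iff[of z] by (auto simp: entry_z unit_cube_iff)
    show "y \<in> G"
    proof (cases "y = z")
      case True
      have "y = b"
      proof (rule rmat_eqI)
        fix i j
        have "(1 + e) * (entry b i j - entry y i j) = 0"
          using entry_z[of i j] True by (simp add: algebra_simps)
        then show "entry y i j = entry b i j"
          using e by simp
      qed
      then show ?thesis using \<open>b \<in> G\<close> by simp
    next
      case False
      define w where "w = 1 / (1 + e)"
      have w: "0 < w" "w < 1" "w * (1 + e) = 1"
        using e by (auto simp: w_def)
      have "b = (1 - w) *\<^sub>R y + w *\<^sub>R z"
      proof (rule rmat_eqI)
        fix i j
        have "(1 - w) * entry y i j + w * entry z i j =
            w * (1 + e) * (entry b i j - entry y i j) + entry y i j"
          unfolding entry_z by (simp add: algebra_simps)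
        also have "\<dots> = entry b i j"
          unfolding w(3) by simp
        finally show "entry b i j = entry ((1 - w) *\<^sub>R y + w *\<^sub>R z) i j"
          by (simp add: lookup_add lookup_scaleR)
      qed
      then have "b \<in> open_segment y z"
        using False w(1,2) unfolding in_segment by blast
      then show ?thesis
        using G y_cube z_cube \<open>b \<in> G\<close> unfolding face_of_def by blast
    qed
  qed
qed

text \<open>
  The relative interior point with entries 1/2 off the fixed positions shows that a face
  determines its index sets.
\<close>

lemma cube_face_index_sets:
  assumes J: "fst J \<subseteq> {..<k} \<times> {..<n}" "snd J \<subseteq> {..<k} \<times> {..<n}" "fst J \<inter> snd J = {}"
  shows "J = constant_positions k n (cube_face k n J)"
proof -
  define p where
    "p = matrix k n (\<lambda>i j. if (i, j) \<in> fst J then 0 else if (i, j) \<in> snd J then 1 else 1 / 2)"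
  have "p \<in> cube_face k n J"
    using J unfolding cube_face_def satisfies_def unit_cube_iff
    by (auto simp: p_def entry_matrix)
  then have "fst (constant_positions k n (cube_face k n J)) \<subseteq> fst J"
    and "snd (constant_positions k n (cube_face k n J)) \<subseteq> snd J"
    by (force simp: constant_positions_def p_def entry_matrix split: if_splits)+
  moreover have "fst J \<subseteq> fst (constant_positions k n (cube_face k n J))"
    and "snd J \<subseteq> snd (constant_positions k n (cube_face k n J))"
    using J by (auto simp: constant_positions_def cube_face_def satisfies_def)
  ultimately show ?thesis
    by (simp add: prod_eq_iff)
qed

lemma Fix_face_empty_iff: "Fix_face k n F P = {} \<longleftrightarrow> P \<inter> F \<inter> binary_mats k n = {}"
proof
  assume "Fix_face k n F P = {}"
  then show "P \<inter> F \<inter> binary_mats k n = {}"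
    unfolding Fix_face_def
    using hull_subset[of "P \<inter> F \<inter> binary_mats k n" "\<lambda>G. G face_of unit_cube k n"] by simp
next
  assume "P \<inter> F \<inter> binary_mats k n = {}"
  then show "Fix_face k n F P = {}"
    unfolding Fix_face_def using hull_minimal[of "{}" "{}"] by (simp add: hull_same)
qed

lemma fix_indices_eq:
  assumes "P \<inter> F \<inter> binary_mats k n \<noteq> {}"
  shows "fix_indices k n F P = constant_positions k n (P \<inter> F \<inter> binary_mats k n)"
    (is "_ = ?J")
proof -
  have face: "Fix_face k n F P = cube_face k n ?J"
    unfolding Fix_face_def using assms by (intro face_hull_binary_eq) auto
  obtain v where "v \<in> P \<inter> F \<inter> binary_mats k n"
    using assms by blast
  then have J: "fst ?J \<subseteq> {..<k} \<times> {..<n}" "snd ?J \<subseteq> {..<k} \<times> {..<n}" "fst ?J \<inter> snd ?J = {}"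
    by (force simp: constant_positions_def)+
  show ?thesis
    unfolding fix_indices_def face
  proof (rule the_equality)
    show "fst ?J \<subseteq> {..<k} \<times> {..<n} \<and> snd ?J \<subseteq> {..<k} \<times> {..<n} \<and> fst ?J \<inter> snd ?J = {} \<and>
        cube_face k n ?J = cube_face k n ?J"
      using J by simp
  next
    fix J'
    assume "fst J' \<subseteq> {..<k} \<times> {..<n} \<and> snd J' \<subseteq> {..<k} \<times> {..<n} \<and> fst J' \<inter> snd J' = {} \<and>
        cube_face k n J' = cube_face k n ?J"
    then show "J' = ?J"
      using cube_face_index_sets[of J' k n] cube_face_index_sets[OF J] by simp
  qed
qed


section \<open>Sorting columns along a row ordering\<close>

definition columns_sorted :: "nat \<Rightarrow> nat list \<Rightarrow> rmat \<Rightarrow> bool" where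
  "columns_sorted n \<phi> x \<longleftrightarrow>
     (\<forall>j. Suc j < n \<longrightarrow>
        lex_geq (length \<phi>) (\<lambda>r. entry x (\<phi> ! r) j) (\<lambda>r. entry x (\<phi> ! r) (Suc j)))"

definition column_list :: "nat \<Rightarrow> nat list \<Rightarrow> rmat \<Rightarrow> real list list" where
  "column_list n \<phi> x = map (\<lambda>j. map (\<lambda>i. entry x i j) \<phi>) [0..<n]"

lemma length_column_list [simp]: "length (column_list n \<phi> x) = n"
  by (simp add: column_list_def)

lemma column_list_nth: "j < n \<Longrightarrow> column_list n \<phi> x ! j = map (\<lambda>i. entry x i j) \<phi>"
  by (simp add: column_list_def)

lemma lex_geq_cong:
  assumes "\<And>i. i < k \<Longrightarrow> y i = y' i" "\<And>i. i < k \<Longrightarrow> z i = z' i"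
  shows "lex_geq k y z = lex_geq k y' z'"
proof -
  have "(\<forall>i'<i. y i' = z i') \<longleftrightarrow> (\<forall>i'<i. y' i' = z' i')" if "i < k" for i
    using assms that by simp
  then show ?thesis
    unfolding lex_geq_def using assms by (simp cong: conj_cong)
qed

lemma lex_geq_SucD: "lex_geq (Suc k) y z \<Longrightarrow> lex_geq k y z"
  unfolding lex_geq_def by (metis less_Suc_eq)

lemma columns_sorted_snocD:
  assumes "columns_sorted n (\<phi> @ [i]) x"
  shows "columns_sorted n \<phi> x"
  unfolding columns_sorted_def
proof (intro allI impI)
  fix j assume "Suc j < n"
  then have "lex_geq (length \<phi>) (\<lambda>r. entry x ((\<phi> @ [i]) ! r) j)
      (\<lambda>r. entry x ((\<phi> @ [i]) ! r) (Suc j))"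
    using assms lex_geq_SucD by (simp add: columns_sorted_def)
  then show "lex_geq (length \<phi>) (\<lambda>r. entry x (\<phi> ! r) j) (\<lambda>r. entry x (\<phi> ! r) (Suc j))"
    by (rule iffD1[OF lex_geq_cong, rotated -1]) (simp_all add: nth_append)
qed

lemma columns_sorted_add_rowD: "columns_sorted n (add_row \<phi> i) x \<Longrightarrow> columns_sorted n \<phi> x"
  unfolding add_row_def using columns_sorted_snocD by (cases "i \<in> set \<phi>") simp_all

text \<open>
  This passes to a linear order on lists, where sorting is available. The first row of
  difference has larger entry exactly when it has a 1 against a 0, since entries are binary.
\<close>

lemma lex_geq_iff_list_le:
  assumes y: "\<And>i. i \<in> set \<phi> \<Longrightarrow> y i = 0 \<or> y i = 1" and z: "\<And>i. i \<in> set \<phi> \<Longrightarrow> z i = 0 \<or> z i = 1"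
  shows "lex_geq (length \<phi>) (\<lambda>r. y (\<phi> ! r)) (\<lambda>r. z (\<phi> ! r)) \<longleftrightarrow> map z \<phi> \<le> map y \<phi>"
proof -
  have "map z \<phi> = map y \<phi> \<longleftrightarrow> (\<forall>r<length \<phi>. y (\<phi> ! r) = z (\<phi> ! r))"
    by (auto simp: list_eq_iff_nth_eq)
  moreover have "map z \<phi> < map y \<phi> \<longleftrightarrow>
      (\<exists>r<length \<phi>. (\<forall>r'<r. y (\<phi> ! r') = z (\<phi> ! r')) \<and> y (\<phi> ! r) = 1 \<and> z (\<phi> ! r) = 0)"
    (is "_ \<longleftrightarrow> ?R")
  proof -
    have prefix: "take r (map z \<phi>) = take r (map y \<phi>) \<longleftrightarrow> (\<forall>r'<r. y (\<phi> ! r') = z (\<phi> ! r'))"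
      if "r < length \<phi>" for r
      using that by (auto simp: list_eq_iff_nth_eq)
    have step: "z (\<phi> ! r) < y (\<phi> ! r) \<longleftrightarrow> y (\<phi> ! r) = 1 \<and> z (\<phi> ! r) = 0"
      if "r < length \<phi>" for r
      using y[of "\<phi> ! r"] z[of "\<phi> ! r"] that by auto
    have "map z \<phi> < map y \<phi> \<longleftrightarrow>
        (\<exists>r<length \<phi>. take r (map z \<phi>) = take r (map y \<phi>) \<and> z (\<phi> ! r) < y (\<phi> ! r))"
      unfolding list_less_def lexord_take_index_conv by auto
    also have "\<dots> \<longleftrightarrow> ?R"
      using prefix step by blast
    finally show ?thesis .
  qed
  ultimately show ?thesis
    unfolding lex_geq_def list_le_def by blast
qed

lemma columns_sorted_iff:
  assumes "x \<in> binary_mats m n"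
  shows "columns_sorted n \<phi> x \<longleftrightarrow> sorted (rev (column_list n \<phi> x))"
  unfolding columns_sorted_def sorted_rev_iff_nth_Suc
  using lex_geq_iff_list_le[of \<phi> "\<lambda>i. entry x i _" "\<lambda>i. entry x i _"] binary_mats_entry[OF assms]
  by (simp add: column_list_nth)

text \<open>A nonincreasing list is determined by the multiset of its elements.\<close>

lemma columns_sorted_agree:
  assumes "x \<in> binary_mats m n" "y \<in> binary_mats m n"
    and "mset (column_list n \<phi> x) = mset (column_list n \<phi> y)"
    and "columns_sorted n \<phi> x" "columns_sorted n \<phi> y"
    and "i \<in> set \<phi>" "j < n"
  shows "entry x i j = entry y i j"
proof -
  have "rev (column_list n \<phi> x) = rev (column_list n \<phi> y)"
    using assms(1-5) properties_for_sort[of "rev (column_list n \<phi> x)" "rev (column_list n \<phi> y)"]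
    by (simp add: columns_sorted_iff sorted_sort_id)
  then have "column_list n \<phi> x ! j = column_list n \<phi> y ! j"
    by simp
  then show ?thesis
    using assms(6,7) by (auto simp: column_list_nth)
qed

lemma column_list_permute_columns:
  assumes "\<pi> permutes {..<n}"
  shows "column_list n \<phi> (permute_columns \<pi> x) = permute_list \<pi> (column_list n \<phi> x)"
proof (rule nth_equalityI)
  fix j assume "j < length (column_list n \<phi> (permute_columns \<pi> x))"
  moreover from this have "\<pi> j < n"
    using permutes_in_image[OF assms] by simp
  ultimately show "column_list n \<phi> (permute_columns \<pi> x) ! j =
      permute_list \<pi> (column_list n \<phi> x) ! j"
    using assms by (simp add: column_list_nth permute_list_nth entry_permute_columns[OF assms])
qed simp

lemma mset_column_list_permute_columns:
  assumes "\<pi> permutes {..<n}"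
  shows "mset (column_list n \<phi> (permute_columns \<pi> x)) = mset (column_list n \<phi> x)"
  using assms by (simp add: column_list_permute_columns)

lemma mset_column_list_in_orbit:
  assumes "orb \<in> solution_orbits n X" "x \<in> orb" "y \<in> orb"
  shows "mset (column_list n \<phi> x) = mset (column_list n \<phi> y)"
  using assms by (auto simp: solution_orbits_def mset_column_list_permute_columns)

text \<open>Any rearrangement of the column list, in particular the sorted one, is a column permutation.\<close>

lemma ex_columns_sorted_in_orbit:
  assumes orb: "orb \<in> solution_orbits n X" "orb \<subseteq> binary_mats m n"
  shows "\<exists>x\<in>orb. columns_sorted n \<phi> x"
proof -
  obtain x where x: "orb = {permute_columns \<pi> x |\<pi>. \<pi> permutes {..<n}}"
    using orb(1) by (auto simp: solution_orbits_def)
  have "mset (rev (sort (column_list n \<phi> x))) = mset (column_list n \<phi> x)"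
    by simp
  then obtain \<pi> where \<pi>: "\<pi> permutes {..<n}"
    "permute_list \<pi> (column_list n \<phi> x) = rev (sort (column_list n \<phi> x))"
    by (rule mset_eq_permutation) simp
  have "permute_columns \<pi> x \<in> orb"
    using x \<pi>(1) by blast
  moreover have "columns_sorted n \<phi> (permute_columns \<pi> x)"
    using calculation orb(2) \<pi> by (auto simp: columns_sorted_iff column_list_permute_columns)
  ultimately show ?thesis by blast
qed

lemma orbit_subset_feasible:
  assumes "column_symmetric_ilp m n X c" "orb \<in> solution_orbits n X"
  shows "orb \<subseteq> X"
  using assms by (auto simp: solution_orbits_def column_symmetric_ilp_def)


section \<open>Orbitopal fixing at one node\<close>

text \<open>
  Taking the convex hull adds no binary matrix, since binary matrices are vertices of the cube.
  This is why a solution of a leaf is itself sorted and not merely a convex combination of sorted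
  matrices.
\<close>

lemma binary_in_convex_hull:
  assumes "v \<in> binary_mats k n" "v \<in> convex hull A" "A \<subseteq> binary_mats k n"
  shows "v \<in> A"
proof -
  have hull: "convex hull A \<subseteq> unit_cube k n"
    using assms(3) binary_mats_subset_unit_cube convex_unit_cube by (intro hull_minimal) auto
  have "v extreme_point_of (convex hull A)"
    unfolding extreme_point_of_def
  proof (intro conjI ballI notI)
    show "v \<in> convex hull A" by fact
    fix a b
    assume ab: "a \<in> convex hull A" "b \<in> convex hull A" and v: "v \<in> open_segment a b"
    then obtain u where u: "0 < u" "u < 1"
      "\<And>i j. entry v i j = (1 - u) * entry a i j + u * entry b i j"
      by (elim entry_open_segment) blast
    have "a = b"
    proof (rule rmat_eqI)
      fix i j
      show "entry a i j = entry b i j"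
        using convex_combination_eq_0[OF u(1,2), of "entry a i j" "entry b i j"]
          convex_combination_eq_1[OF u(1,2), of "entry a i j" "entry b i j"]
          u(3)[of i j] binary_mats_entry[OF assms(1), of i j]
          unit_cube_entry[OF subsetD[OF hull ab(1)], of i j]
          unit_cube_entry[OF subsetD[OF hull ab(2)], of i j]
        by auto
    qed
    then show False
      using v by simp
  qed
  then show ?thesis
    by (rule extreme_point_of_convex_hull)
qed

text \<open>
  A choice is a matrix of the selected rows only: its row \<open>r\<close> stands for the row \<open>\<phi> ! r\<close> of the large
  matrix. These are the vertices whose smallest common face orbitopal fixing computes.
\<close>

definition sorted_choices :: "nat \<Rightarrow> nat list \<Rightarrow> fixing \<Rightarrow> rmat set" where
  "sorted_choices n \<phi> S =
     {v \<in> binary_mats (length \<phi>) n.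
        (\<forall>j. Suc j < n \<longrightarrow> lex_geq (length \<phi>) (\<lambda>r. entry v r j) (\<lambda>r. entry v r (Suc j))) \<and>
        satisfies v (restrict_fixing n \<phi> S)}"

lemma full_orbitope_Int_face_Int_binary:
  "full_orbitope (length \<phi>) n \<inter> cube_face (length \<phi>) n (restrict_fixing n \<phi> S) \<inter>
     binary_mats (length \<phi>) n = sorted_choices n \<phi> S"
  (is "?P \<inter> ?F \<inter> ?B = _")
proof
  show "?P \<inter> ?F \<inter> ?B \<subseteq> sorted_choices n \<phi> S"
    using binary_in_convex_hull[of _ "length \<phi>" n]
    unfolding full_orbitope_def cube_face_def sorted_choices_def by blast
  show "sorted_choices n \<phi> S \<subseteq> ?P \<inter> ?F \<inter> ?B"
    using binary_mats_subset_unit_cube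
    unfolding full_orbitope_def cube_face_def sorted_choices_def
    by (auto intro!: hull_inc)
qed

lemma orbitopal_fixing_eq_None_iff:
  "orbitopal_fixing n \<phi> S = None \<longleftrightarrow> sorted_choices n \<phi> S = {}"
  by (simp add: orbitopal_fixing_def Let_def Fix_face_empty_iff full_orbitope_Int_face_Int_binary)

lemma orbitopal_fixing_eq_SomeD:
  assumes "orbitopal_fixing n \<phi> S = Some T"
  defines "J \<equiv> constant_positions (length \<phi>) n (sorted_choices n \<phi> S)"
  shows "sorted_choices n \<phi> S \<noteq> {}"
    and "T = (fst S \<union> {(\<phi> ! r, j) |r j. (r, j) \<in> fst J}, snd S \<union> {(\<phi> ! r, j) |r j. (r, j) \<in> snd J})"
proof -
  show ne: "sorted_choices n \<phi> S \<noteq> {}"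
    using assms(1) orbitopal_fixing_eq_None_iff by (metis option.distinct(1))
  then show "T = (fst S \<union> {(\<phi> ! r, j) |r j. (r, j) \<in> fst J}, snd S \<union> {(\<phi> ! r, j) |r j. (r, j) \<in> snd J})"
    using assms(1) unfolding orbitopal_fixing_def Let_def J_def
    by (simp add: Fix_face_empty_iff fix_indices_eq full_orbitope_Int_face_Int_binary)
qed

lemma orbitopal_fixing_satisfies_mono:
  "orbitopal_fixing n \<phi> S = Some T \<Longrightarrow> satisfies x T \<Longrightarrow> satisfies x S"
  by (drule orbitopal_fixing_eq_SomeD(2)) (auto simp: satisfies_def)

lemma orbitopal_fixing_rows:
  assumes "orbitopal_fixing n \<phi> S = Some T" "fst S \<union> snd S \<subseteq> set \<phi> \<times> {..<n}"
  shows "fst T \<union> snd T \<subseteq> set \<phi> \<times> {..<n}"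
  using orbitopal_fixing_eq_SomeD(2)[OF assms(1)] assms(2)
  by (auto simp: constant_positions_def)

text \<open>
  The rows \<open>\<phi>\<close> of such a matrix form one of the sorted choices. So there is a choice, and the new
  fixings, being common to all choices, hold for this one.
\<close>

lemma orbitopal_fixing_keeps_sorted:
  assumes x: "x \<in> binary_mats m n" "columns_sorted n \<phi> x" "satisfies x S"
  obtains T where "orbitopal_fixing n \<phi> S = Some T" "satisfies x T"
proof -
  define v where "v = matrix (length \<phi>) n (\<lambda>r j. entry x (\<phi> ! r) j)"
  have entry_v: "entry v r j = entry x (\<phi> ! r) j" if "r < length \<phi>" "j < n" for r j
    using that by (simp add: v_def entry_matrix)
  have "v \<in> binary_mats (length \<phi>) n"
    using binary_mats_entry[OF x(1)] unfolding binary_mats_iff v_def entry_matrix by auto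
  moreover have "lex_geq (length \<phi>) (\<lambda>r. entry v r j) (\<lambda>r. entry v r (Suc j))" if "Suc j < n" for j
  proof -
    have "lex_geq (length \<phi>) (\<lambda>r. entry x (\<phi> ! r) j) (\<lambda>r. entry x (\<phi> ! r) (Suc j))"
      using x(2) that by (simp add: columns_sorted_def)
    then show ?thesis
      by (rule iffD1[OF lex_geq_cong, rotated -1]) (use that in \<open>simp_all add: entry_v\<close>)
  qed
  moreover have "satisfies v (restrict_fixing n \<phi> S)"
    using x(3) by (auto simp: satisfies_def restrict_fixing_def entry_v)
  ultimately have v: "v \<in> sorted_choices n \<phi> S"
    by (simp add: sorted_choices_def)
  then obtain T where T: "orbitopal_fixing n \<phi> S = Some T"
    using orbitopal_fixing_eq_None_iff[of n \<phi> S] by blast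
  moreover have "satisfies x T"
    unfolding orbitopal_fixing_eq_SomeD(2)[OF T]
    using v x(3) entry_v by (fastforce simp: satisfies_def constant_positions_def)
  ultimately show ?thesis
    using that by blast
qed

text \<open>
  Once all entries of the rows \<open>\<phi>\<close> are fixed, there is exactly one sorted choice of these rows, and
  every matrix that respects the fixings extends it.
\<close>

lemma orbitopal_fixing_complete_sorted:
  assumes T: "orbitopal_fixing n \<phi> S = Some T"
    and x: "satisfies x T"
    and complete: "set \<phi> \<times> {..<n} \<subseteq> fst T \<union> snd T"
    and "distinct \<phi>"
  shows "columns_sorted n \<phi> x"
proof -
  note T_eq = orbitopal_fixing_eq_SomeD(2)[OF T]
  obtain v where v: "v \<in> sorted_choices n \<phi> S"
    using orbitopal_fixing_eq_SomeD(1)[OF T] by blast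
  then have vS: "satisfies v (restrict_fixing n \<phi> S)"
    by (simp add: sorted_choices_def)
  have agree: "entry v r j = entry x (\<phi> ! r) j" if rj: "r < length \<phi>" "j < n" for r j
  proof -
    have same: "r' = r" if "\<phi> ! r' = \<phi> ! r" "r' < length \<phi>" for r'
      using that rj \<open>distinct \<phi>\<close> nth_eq_iff_index_eq by blast
    have "(\<phi> ! r, j) \<in> fst T \<union> snd T"
      using rj by (intro subsetD[OF complete]) simp
    then consider "(\<phi> ! r, j) \<in> fst T" | "(\<phi> ! r, j) \<in> snd T" by blast
    then show ?thesis
    proof cases
      case 1
      then have "(\<phi> ! r, j) \<in> fst S \<or>
          (r, j) \<in> fst (constant_positions (length \<phi>) n (sorted_choices n \<phi> S))"
        unfolding T_eq using same by (fastforce simp: constant_positions_def)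
      then have "entry v r j = 0"
        using v vS rj by (auto simp: satisfies_def restrict_fixing_def constant_positions_def)
      then show ?thesis
        using 1 x by (auto simp: satisfies_def)
    next
      case 2
      then have "(\<phi> ! r, j) \<in> snd S \<or>
          (r, j) \<in> snd (constant_positions (length \<phi>) n (sorted_choices n \<phi> S))"
        unfolding T_eq using same by (fastforce simp: constant_positions_def)
      then have "entry v r j = 1"
        using v vS rj by (auto simp: satisfies_def restrict_fixing_def constant_positions_def)
      then show ?thesis
        using 2 x by (auto simp: satisfies_def)
    qed
  qed
  show ?thesis
    unfolding columns_sorted_def
  proof (intro allI impI)
    fix j assume j: "Suc j < n"
    then have "lex_geq (length \<phi>) (\<lambda>r. entry v r j) (\<lambda>r. entry v r (Suc j))"
      using v by (simp add: sorted_choices_def)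
    then show "lex_geq (length \<phi>) (\<lambda>r. entry x (\<phi> ! r) j) (\<lambda>r. entry x (\<phi> ! r) (Suc j))"
      by (rule iffD1[OF lex_geq_cong, rotated -1]) (use j in \<open>simp_all add: agree\<close>)
  qed
qed


section \<open>Enumeration along the branch-and-bound tree\<close>

lemma set_add_row: "set (add_row \<phi> i) = insert i (set \<phi>)"
  by (auto simp: add_row_def)

lemma distinct_add_row: "distinct \<phi> \<Longrightarrow> distinct (add_row \<phi> i)"
  by (simp add: add_row_def)

text \<open>
  At the leaf itself all entries are fixed, so its solution is the sorted choice found there. The
  property passes up to the root because the ordering of a father is a prefix of that of its children.
\<close>

lemma leaf_solution_sorted:
  assumes "dof_tree m n X \<phi> S t" "distinct \<phi>" "set \<phi> \<subseteq> {..<m}" "T \<in> leaves t" "satisfies x T"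
  shows "columns_sorted n \<phi> x \<and> satisfies x S"
  using assms
proof (induction)
  case (pruned_by_fixing \<phi> S)
  then show ?case by simp
next
  case (infeasible \<phi> S T)
  then show ?case by simp
next
  case (leaf \<phi> S T')
  then have "satisfies x T'" "set \<phi> \<times> {..<n} \<subseteq> fst T' \<union> snd T'"
    by auto
  then show ?case
    using leaf orbitopal_fixing_complete_sorted orbitopal_fixing_satisfies_mono by blast
next
  case (branch i j \<phi> S T0 T1 t0 t1)
  then have "distinct (add_row \<phi> i)" "set (add_row \<phi> i) \<subseteq> {..<m}"
    by (auto simp: set_add_row distinct_add_row)
  with branch have "columns_sorted n (add_row \<phi> i) x \<and>
      (satisfies x (insert (i, j) T0, T1) \<or> satisfies x (T0, insert (i, j) T1))"
    by auto
  then have "columns_sorted n (add_row \<phi> i) x" "satisfies x (T0, T1)"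
    by (auto simp: satisfies_def)
  then show ?case
    using branch.hyps(3) columns_sorted_add_rowD orbitopal_fixing_satisfies_mono by blast
qed

text \<open>
  In the branching case the given element of the orbit need not be sorted on the extended ordering.
  A sorted one takes its place; it respects the fixings because these only concern the old rows.
\<close>

lemma enumerated_exists:
  assumes "dof_tree m n X \<phi> S t"
    and "orb \<in> solution_orbits n X" "orb \<subseteq> X" "X \<subseteq> binary_mats m n"
    and "fst S \<union> snd S \<subseteq> set \<phi> \<times> {..<n}"
    and "x \<in> orb" "columns_sorted n \<phi> x" "satisfies x S"
  shows "\<exists>y\<in>orb. \<exists>T\<in>leaves t. satisfies y T"
  using assms
proof (induction arbitrary: x)
  case (pruned_by_fixing \<phi> S)
  then have "x \<in> binary_mats m n" by blast
  then show ?case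
    using pruned_by_fixing orbitopal_fixing_keeps_sorted
    by (metis option.distinct(1))
next
  case (infeasible \<phi> S T)
  then have "x \<in> binary_mats m n" "x \<in> X" by blast+
  then show ?case
    using infeasible orbitopal_fixing_keeps_sorted by (metis option.inject)
next
  case (leaf \<phi> S T)
  then have "x \<in> binary_mats m n" by blast
  then have "satisfies x T"
    using leaf orbitopal_fixing_keeps_sorted by (metis option.inject)
  then show ?case
    using leaf by auto
next
  case (branch i j \<phi> S T0 T1 t0 t1)
  have orb_bin: "orb \<subseteq> binary_mats m n"
    using branch.prems by blast
  obtain y where y: "y \<in> orb" "columns_sorted n (add_row \<phi> i) y"
    using ex_columns_sorted_in_orbit[OF branch.prems(1) orb_bin] by blast
  have "entry y i' j' = entry x i' j'" if "(i', j') \<in> fst S \<union> snd S" for i' j'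
  proof (rule columns_sorted_agree)
    show "mset (column_list n \<phi> y) = mset (column_list n \<phi> x)"
      using mset_column_list_in_orbit branch.prems(1,5) y(1) by blast
    show "columns_sorted n \<phi> y"
      using y(2) by (rule columns_sorted_add_rowD)
    show "i' \<in> set \<phi>" "j' < n"
      using that branch.prems(4) by auto
  qed (use orb_bin y branch.prems in auto)
  then have "satisfies y S"
    using branch.prems(7) by (auto simp: satisfies_def)
  then have yT: "satisfies y (T0, T1)"
    using branch.hyps(3) y orb_bin orbitopal_fixing_keeps_sorted by (metis option.inject subsetD)
  have "fst S \<union> snd S \<subseteq> set (add_row \<phi> i) \<times> {..<n}"
    using branch.prems(4) by (auto simp: set_add_row)
  then have "T0 \<union> T1 \<subseteq> set (add_row \<phi> i) \<times> {..<n}"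
    using orbitopal_fixing_rows[OF branch.hyps(3)] by simp
  then have rows: "fst (insert (i, j) T0, T1) \<union> snd (insert (i, j) T0, T1) \<subseteq> set (add_row \<phi> i) \<times> {..<n}"
    "fst (T0, insert (i, j) T1) \<union> snd (T0, insert (i, j) T1) \<subseteq> set (add_row \<phi> i) \<times> {..<n}"
    using branch.hyps(2) by (auto simp: set_add_row)
  consider "entry y i j = 0" | "entry y i j = 1"
    using y(1) orb_bin binary_mats_entry by blast
  then show ?case
  proof cases
    case 1
    then have "satisfies y (insert (i, j) T0, T1)"
      using yT by (auto simp: satisfies_def)
    then show ?thesis
      using branch.IH(1)[OF branch.prems(1-3) rows(1) y] by auto
  next
    case 2
    then have "satisfies y (T0, insert (i, j) T1)"
      using yT by (auto simp: satisfies_def)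
    then show ?thesis
      using branch.IH(2)[OF branch.prems(1-3) rows(2) y] by auto
  qed
qed

text \<open>
  At a branched node both matrices are sorted on an ordering containing the branching row,
  so they have the same entry at the branching position and lie in the same subtree.
\<close>

lemma enumerated_unique:
  assumes "dof_tree m n X \<phi> S t" "distinct \<phi>" "set \<phi> \<subseteq> {..<m}"
    and "x \<in> binary_mats m n" "y \<in> binary_mats m n"
    and "\<And>\<psi>. mset (column_list n \<psi> x) = mset (column_list n \<psi> y)"
    and "T \<in> leaves t" "satisfies x T" "T' \<in> leaves t" "satisfies y T'"
  shows "x = y"
  using assms
proof (induction)
  case (pruned_by_fixing \<phi> S)
  then show ?case by simp
next
  case (infeasible \<phi> S T)
  then show ?case by simp
next
  case (leaf \<phi> S T'')
  then have xy: "satisfies x T''" "satisfies y T''" by auto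
  show ?case
  proof (rule rmat_eqI)
    fix i j
    show "entry x i j = entry y i j"
    proof (cases "i < m \<and> j < n")
      case True
      then have "(i, j) \<in> fst T'' \<union> snd T''"
        using leaf.hyps(2) by simp
      then show ?thesis
        using xy by (auto simp: satisfies_def)
    next
      case False
      then show ?thesis
        using leaf.prems(3,4) by (auto simp: binary_mats_iff)
    qed
  qed
next
  case (branch i j \<phi> S T0 T1 t0 t1)
  have \<phi>': "distinct (add_row \<phi> i)" "set (add_row \<phi> i) \<subseteq> {..<m}"
    using branch.prems branch.hyps by (auto simp: set_add_row distinct_add_row)
  have side: "columns_sorted n (add_row \<phi> i) z \<and>
      (U \<in> leaves t0 \<and> entry z i j = 0 \<or> U \<in> leaves t1 \<and> entry z i j = 1)"
    if "U \<in> leaves (Branch (i, j) t0 t1)" "satisfies z U" for U z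
    using that leaf_solution_sorted[OF branch.hyps(4) \<phi>', of U z]
      leaf_solution_sorted[OF branch.hyps(5) \<phi>', of U z]
    by (auto simp: satisfies_def)
  have "entry x i j = entry y i j"
    by (rule columns_sorted_agree[of x m n y "add_row \<phi> i"])
      (use branch.prems branch.hyps side in \<open>auto simp: set_add_row\<close>)
  then consider "T \<in> leaves t0" "T' \<in> leaves t0" | "T \<in> leaves t1" "T' \<in> leaves t1"
    using side[OF branch.prems(6,7)] side[OF branch.prems(8,9)] by force
  then show ?case
    using branch.IH \<phi>' branch.prems by cases blast+
qed

theorem theorem5:
  fixes m n :: nat and X :: "rmat set" and c :: "rmat \<Rightarrow> real"
    and \<tau> :: bb_tree and orb :: "rmat set"
  assumes "column_symmetric_ilp m n X c"
    and "dynamic_orbitopal_bb_tree m n X \<tau>"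
    and "orb \<in> solution_orbits n X"
  shows "\<exists>!x. x \<in> orb \<and> x \<in> enumerated X \<tau>"
proof -
  have tree: "dof_tree m n X [] ({}, {}) \<tau>"
    using assms(2) by (simp add: dynamic_orbitopal_bb_tree_def)
  have X: "X \<subseteq> binary_mats m n"
    using assms(1) by (simp add: column_symmetric_ilp_def)
  have orb: "orb \<subseteq> X"
    using assms(1,3) by (rule orbit_subset_feasible)
  obtain x where x: "x \<in> orb" "columns_sorted n [] x"
    using ex_columns_sorted_in_orbit[OF assms(3)] orb X by blast
  have "satisfies x ({}, {})"
    by (simp add: satisfies_def)
  then obtain y where "y \<in> orb" "\<exists>T\<in>leaves \<tau>. satisfies y T"
    using enumerated_exists[OF tree assms(3) orb X _ x] by auto
  then have "y \<in> orb \<and> y \<in> enumerated X \<tau>"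
    using orb by (auto simp: enumerated_def)
  moreover have "z = z'" if "z \<in> orb" "z \<in> enumerated X \<tau>" "z' \<in> orb" "z' \<in> enumerated X \<tau>" for z z'
  proof -
    obtain T T' where "T \<in> leaves \<tau>" "satisfies z T" "T' \<in> leaves \<tau>" "satisfies z' T'"
      using \<open>z \<in> enumerated X \<tau>\<close> \<open>z' \<in> enumerated X \<tau>\<close> by (auto simp: enumerated_def)
    moreover have "z \<in> binary_mats m n" "z' \<in> binary_mats m n"
      using \<open>z \<in> orb\<close> \<open>z' \<in> orb\<close> orb X by auto
    ultimately show ?thesis
      using mset_column_list_in_orbit[OF assms(3) \<open>z \<in> orb\<close> \<open>z' \<in> orb\<close>]
      by (intro enumerated_unique[OF tree]) auto
  qed
  ultimately show ?thesis by blast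
qed

end
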